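(* Let $(A_n)_{n\ge 0}$ be a second-order linear recurrence sequence with initial term $A_0=1$ and with recurrence $$A_n=c_1A_{n-1}+c_2A_{n-2}\qquad (n\ge 2).$$ Set $t=c_1-A_1$. If $t\ne 0$, then for every integer $n\ge 0$, $$A_{n+2}-A_1A_{n+1}=\left(A_2-A_1^2\right)\sum_{i=0}^{n}t^{n-i}A_i.$$
   Context: Sequences and the constants $c_1,c_2$ take values in the real (or complex) numbers. "Second-order" means that $c_2\neq 0$. *)

theory Defs
  imports Complex_Main
begin

end

theory Submission
  imports Defs
begin

text \<open>
  Put \<open>D n = A (n + 2) - A 1 * A (n + 1)\<close> and \<open>K = A 2 - (A 1)\<^sup>2\<close>. Since \<open>A 0 = 1\<close>, the
  recurrence at index 2 gives \<open>K = t * A 1 + c2\<close>, which is exactly the coefficient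
  needed to lower the order of the recurrence by one:
  \<open>D (n + 1) = t * A (n + 2) + c2 * A (n + 1) = t * D n + K * A (n + 1)\<close>.
  Together with \<open>D 0 = K * A 0\<close>, this is a first-order inhomogeneous recurrence for \<open>D\<close>.
  Its solution is the convolution of the source \<open>K * A i\<close> with the powers of \<open>t\<close>
  (lemma \<open>first_order_recurrence_solution\<close>), from which the constant \<open>K\<close> factors out.
\<close>

text \<open>
  A source term \<open>f i\<close> entering at time \<open>i\<close> is multiplied by \<open>t\<close> at each of the
  remaining \<open>n - i\<close> steps (discrete variation of constants, Horner's scheme).
\<close>

lemma first_order_recurrence_solution:
  fixes D f :: "nat \<Rightarrow> 'a :: comm_semiring_1"
  assumes "D 0 = f 0"
    and "\<And>n. D (Suc n) = t * D n + f (Suc n)"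
  shows "D n = (\<Sum>i=0..n. t ^ (n - i) * f i)"
proof (induction n)
  case 0
  show ?case using assms(1) by simp
next
  case (Suc n)
  have "(\<Sum>i=0..n. t ^ (Suc n - i) * f i) = t * (\<Sum>i=0..n. t ^ (n - i) * f i)"
    by (simp add: sum_distrib_left Suc_diff_le mult.assoc)
  then show ?case using assms(2) Suc.IH by simp
qed

theorem theorem1:
  fixes A :: "nat \<Rightarrow> 'a :: real_normed_field" and c1 c2 t :: 'a
  assumes second_order: "c2 \<noteq> 0"
    and init: "A 0 = 1"
    and recurrence: "\<And>n. n \<ge> 2 \<Longrightarrow> A n = c1 * A (n - 1) + c2 * A (n - 2)"
    and t_eq: "t = c1 - A 1"
    and t_nonzero: "t \<noteq> 0"
  shows "\<forall>n. A (n + 2) - A 1 * A (n + 1) = (A 2 - (A 1)\<^sup>2) * (\<Sum>i=0..n. t ^ (n - i) * A i)"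
proof
  fix n
  define D where "D = (\<lambda>n. A (n + 2) - A 1 * A (n + 1))"
  define K where "K = A 2 - (A 1)\<^sup>2"
  have K: "K = t * A 1 + c2"
    using recurrence[of 2] init
    by (simp add: K_def t_eq power2_eq_square algebra_simps)
  have start: "D 0 = K * A 0"
    by (simp add: D_def K_def init power2_eq_square numeral_2_eq_2)
  have step: "D (Suc n) = t * D n + K * A (Suc n)" for n
  proof -
    have "A (Suc n + 2) = c1 * A (n + 2) + c2 * A (n + 1)"
      using recurrence[of "Suc n + 2"] by simp
    then show ?thesis
      unfolding D_def K t_eq by (simp add: algebra_simps)
  qed
  have "D n = (\<Sum>i=0..n. t ^ (n - i) * (K * A i))"
    using start step by (rule first_order_recurrence_solution)
  also have "\<dots> = K * (\<Sum>i=0..n. t ^ (n - i) * A i)"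
    by (simp add: sum_distrib_left mult.left_commute)
  finally show "A (n + 2) - A 1 * A (n + 1) = (A 2 - (A 1)\<^sup>2) * (\<Sum>i=0..n. t ^ (n - i) * A i)"
    by (simp add: D_def K_def)
qed

end
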